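(* Let $(\Omega,(\mathcal F_k)_{k=0}^n,\mathbb P)$ be a filtered probability space and let $(F_k)_{k=0}^n$ be an integrable $(\mathcal F_k)$-martingale with differences $\Delta F_k=F_k-F_{k-1}$. Then $$\mathbb E\Big(\sum_{k=1}^n|\Delta F_k|^2\Big)^{1/2}\le 2\,\mathbb E\Big(\sum_{k=1}^n\mathbb E_{k-1}\big(|\Delta F_k|^2\big)\Big)^{1/2}.$$
   Context: $\mathbb E$ is expectation on $(\Omega,\mathbb P)$ and $\mathbb E_k$ is conditional expectation with respect to $\mathcal F_k$ (for non-negative, possibly non-integrable random variables it takes values in $[0,\infty]$). The martingale is complex (or real) valued; the right-hand side may be $+\infty$. *)

theory Defs
  imports "HOL-Probability.Probability"
begin

definition filtered_prob_space :: "'a measure \<Rightarrow> (nat \<Rightarrow> 'a measure) \<Rightarrow> nat \<Rightarrow> bool" where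
  "filtered_prob_space M G n \<longleftrightarrow>
     prob_space M \<and>
     (\<forall>k\<le>n. subalgebra M (G k)) \<and>
     (\<forall>j k. j \<le> k \<longrightarrow> k \<le> n \<longrightarrow> subalgebra (G k) (G j))"

text \<open>The library's \<^const>\<open>real_cond_exp\<close> is real-valued; for a complex integrand,
  conditional expectation is taken on real and imaginary parts.\<close>

definition complex_cond_exp ::
    "'a measure \<Rightarrow> 'a measure \<Rightarrow> ('a \<Rightarrow> complex) \<Rightarrow> 'a \<Rightarrow> complex" where
  "complex_cond_exp M G f = (\<lambda>\<omega>.
     Complex (real_cond_exp M G (\<lambda>x. Re (f x)) \<omega>) (real_cond_exp M G (\<lambda>x. Im (f x)) \<omega>))"

text \<open>Only the indices \<open>0, \<dots>, n\<close> of \<open>G\<close> and \<open>F\<close> are constrained.\<close>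

definition martingale_upto ::
    "'a measure \<Rightarrow> (nat \<Rightarrow> 'a measure) \<Rightarrow> nat \<Rightarrow> (nat \<Rightarrow> 'a \<Rightarrow> complex) \<Rightarrow> bool" where
  "martingale_upto M G n F \<longleftrightarrow>
     (\<forall>k\<le>n. F k \<in> borel_measurable (G k)) \<and>
     (\<forall>k\<le>n. integrable M (F k)) \<and>
     (\<forall>k\<in>{1..n}. AE \<omega> in M. complex_cond_exp M (G (k - 1)) (F k) \<omega> = F (k - 1) \<omega>)"

text \<open>Meaningful for \<open>k \<ge> 1\<close> only, since subtraction on \<^typ>\<open>nat\<close> truncates.\<close>

definition mdiff :: "(nat \<Rightarrow> 'a \<Rightarrow> complex) \<Rightarrow> nat \<Rightarrow> 'a \<Rightarrow> complex" where
  "mdiff F k \<omega> = F k \<omega> - F (k - 1) \<omega>"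

text \<open>Conditional expectations of non-negative functions, and hence their sums, may be infinite.\<close>

definition ennreal_sqrt :: "ennreal \<Rightarrow> ennreal" where
  "ennreal_sqrt x = (if x = \<infinity> then \<infinity> else ennreal (sqrt (enn2real x)))"

lemma ennreal_sqrt_power2: "(ennreal_sqrt x)\<^sup>2 = x"
  by (cases x) (auto simp: ennreal_sqrt_def ennreal_power top_power_ennreal)

end

theory Submission
  imports Defs
begin

text \<open>The inequality holds for arbitrary non-negative \<open>f\<^sub>k\<close>, here \<open>f\<^sub>k = |\<Delta>F\<^sub>k|\<^sup>2\<close>, in
  place of squared martingale differences, and even with the constant \<open>3/2\<close>. Put
  \<open>a\<^sub>k = E\<^sub>k\<^sub>-\<^sub>1 f\<^sub>k\<close>, \<open>A\<^sub>k = a\<^sub>1 + \<dots> + a\<^sub>k\<close> and \<open>X = f\<^sub>1 + \<dots> + f\<^sub>n\<close>. By AM-GM,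
  \<open>2 \<surd>X \<le> X / \<surd>A\<^sub>n + \<surd>A\<^sub>n \<le> (\<Sum>k. f\<^sub>k / \<surd>A\<^sub>k) + \<surd>A\<^sub>n\<close>. Since \<open>A\<^sub>k\<close> is
  \<open>F\<^sub>k\<^sub>-\<^sub>1\<close>-measurable, \<open>f\<^sub>k\<close> may be replaced by \<open>a\<^sub>k\<close> under the expectation, and
  \<open>a\<^sub>k / \<surd>A\<^sub>k \<le> 2 (\<surd>A\<^sub>k - \<surd>A\<^sub>k\<^sub>-\<^sub>1)\<close> telescopes to \<open>2 \<surd>A\<^sub>n\<close>.
  All of this takes place in \<^typ>\<open>ennreal\<close>, where \<open>inverse 0 = \<infinity>\<close>, \<open>inverse \<infinity> = 0\<close> and
  \<open>0 * \<infinity> = 0\<close> make each step valid also when \<open>A\<^sub>k\<close> is \<open>0\<close> or \<open>\<infinity>\<close>.\<close>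

lemma ennreal_sqrt_0 [simp]: "ennreal_sqrt 0 = 0"
  by (simp add: ennreal_sqrt_def)

lemma ennreal_sqrt_top [simp]: "ennreal_sqrt \<top> = \<top>"
  by (simp add: ennreal_sqrt_def)

lemma ennreal_sqrt_ennreal: "0 \<le> x \<Longrightarrow> ennreal_sqrt (ennreal x) = ennreal (sqrt x)"
  by (simp add: ennreal_sqrt_def)

lemma ennreal_sqrt_mono: "x \<le> y \<Longrightarrow> ennreal_sqrt x \<le> ennreal_sqrt y"
  by (cases x; cases y)
    (auto simp: ennreal_sqrt_ennreal top_unique intro!: ennreal_leI)

lemma borel_measurable_ennreal_sqrt [measurable]: "ennreal_sqrt \<in> borel_measurable borel"
  unfolding ennreal_sqrt_def by measurable

lemma inverse_ennreal_antimono: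
  fixes x y :: ennreal
  assumes "x \<le> y"
  shows "inverse y \<le> inverse x"
proof (cases "x = 0 \<or> y = \<top>")
  case False
  then obtain r s where "x = ennreal r" "y = ennreal s" "0 < r" "r \<le> s"
    using assms by (cases x; cases y) (auto simp: less_le top_unique)
  then show ?thesis
    by (auto simp: inverse_ennreal intro!: ennreal_leI le_imp_inverse_le)
qed auto

text \<open>For finite positive arguments, expand \<open>0 \<le> (sqrt r - sqrt s)\<^sup>2\<close>
  and divide by \<open>sqrt s\<close>. Otherwise the left side is 0 or the right side is
  infinite.\<close>

lemma two_ennreal_sqrt_le:
  "2 * ennreal_sqrt x \<le> x * inverse (ennreal_sqrt y) + ennreal_sqrt y"
proof (cases "x = 0 \<or> y = 0 \<or> x = \<top> \<or> y = \<top>")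
  case True
  then show ?thesis
    by (cases y) (auto simp: ennreal_mult_top ennreal_top_mult ennreal_sqrt_ennreal)
next
  case False
  then obtain r s where rs: "x = ennreal r" "y = ennreal s" "0 < r" "0 < s"
    by (cases x; cases y) (auto simp: less_le)
  have "0 \<le> (sqrt r - sqrt s)\<^sup>2"
    by simp
  then have "2 * sqrt r * sqrt s \<le> r + s"
    using rs by (simp add: power2_diff)
  then have "2 * sqrt r \<le> r / sqrt s + sqrt s"
    using rs by (simp add: field_simps)
  then show ?thesis
    using rs by (simp add: ennreal_sqrt_ennreal inverse_ennreal ennreal_mult' [symmetric]
        ennreal_plus [symmetric] divide_inverse flip: ennreal_numeral del: ennreal_plus)
qed

text \<open>Concavity of the square root, from
  \<open>0 \<le> (sqrt (r + s) - sqrt r)\<^sup>2\<close>. The additive form avoids a difference of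
  possibly infinite square roots.\<close>

lemma increment_ennreal_sqrt:
  "a * inverse (ennreal_sqrt (x + a)) + 2 * ennreal_sqrt x \<le> 2 * ennreal_sqrt (x + a)"
proof (cases "a = 0 \<or> x + a = \<top>")
  case True
  then show ?thesis
    by (auto simp: ennreal_mult_top)
next
  case False
  then obtain r s where rs: "x = ennreal r" "a = ennreal s" "0 \<le> r" "0 < s"
    by (cases x; cases a) (auto simp: less_le)
  have "0 \<le> (sqrt (r + s) - sqrt r)\<^sup>2"
    by simp
  then have "s + 2 * sqrt r * sqrt (r + s) \<le> 2 * (r + s)"
    using rs by (simp add: power2_diff mult.commute mult.left_commute)
  then have "s + 2 * sqrt r * sqrt (r + s) \<le> 2 * (sqrt (r + s) * sqrt (r + s))"
    using rs by simp
  then have "s / sqrt (r + s) + 2 * sqrt r \<le> 2 * sqrt (r + s)"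
    using rs by (simp add: divide_simps algebra_simps)
  then show ?thesis
    using rs by (simp add: ennreal_sqrt_ennreal inverse_ennreal ennreal_mult' [symmetric]
        ennreal_plus [symmetric] divide_inverse flip: ennreal_numeral del: ennreal_plus)
qed

lemma sum_increments_ennreal_sqrt:
  fixes a :: "nat \<Rightarrow> ennreal"
  shows "(\<Sum>k=1..n. a k * inverse (ennreal_sqrt (\<Sum>j=1..k. a j)))
    \<le> 2 * ennreal_sqrt (\<Sum>j=1..n. a j)"
proof (induction n)
  case (Suc n)
  have "(\<Sum>k=1..Suc n. a k * inverse (ennreal_sqrt (\<Sum>j=1..k. a j)))
      \<le> a (Suc n) * inverse (ennreal_sqrt ((\<Sum>j=1..n. a j) + a (Suc n)))
        + 2 * ennreal_sqrt (\<Sum>j=1..n. a j)"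
    using add_left_mono [OF Suc.IH] by (simp add: add.commute)
  also have "\<dots> \<le> 2 * ennreal_sqrt (\<Sum>j=1..Suc n. a j)"
    using increment_ennreal_sqrt by simp
  finally show ?case .
qed simp

text \<open>AM-GM yields the last, smallest weight for every \<open>f k\<close>. Since the weights
  decrease in \<open>k\<close>, it may be enlarged to the \<open>k\<close>-th one, which depends
  only on \<open>a 1\<close>, ..., \<open>a k\<close>.\<close>

lemma sum_ennreal_sqrt_le:
  fixes f a :: "nat \<Rightarrow> ennreal"
  shows "2 * ennreal_sqrt (\<Sum>k=1..n. f k)
    \<le> (\<Sum>k=1..n. f k * inverse (ennreal_sqrt (\<Sum>j=1..k. a j))) + ennreal_sqrt (\<Sum>j=1..n. a j)"
proof -
  have "(\<Sum>k=1..n. f k) * inverse (ennreal_sqrt (\<Sum>j=1..n. a j))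
    \<le> (\<Sum>k=1..n. f k * inverse (ennreal_sqrt (\<Sum>j=1..k. a j)))"
    unfolding sum_distrib_right
    by (intro sum_mono mult_left_mono inverse_ennreal_antimono ennreal_sqrt_mono sum_mono2) auto
  then show ?thesis
    using two_ennreal_sqrt_le by (meson add_right_mono order_trans)
qed

lemma (in prob_space) nn_integral_ennreal_sqrt_sum_le:
  fixes f :: "nat \<Rightarrow> 'a \<Rightarrow> ennreal"
  assumes filt: "filtered_prob_space M G n"
    and f [measurable]: "\<And>k. k \<in> {1..n} \<Longrightarrow> f k \<in> borel_measurable M"
  shows "2 * (\<integral>\<^sup>+ \<omega>. ennreal_sqrt (\<Sum>k=1..n. f k \<omega>) \<partial>M)
    \<le> 3 * (\<integral>\<^sup>+ \<omega>. ennreal_sqrt (\<Sum>k=1..n. nn_cond_exp M (G (k - 1)) (f k) \<omega>) \<partial>M)"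
proof -
  define a where "a k = nn_cond_exp M (G (k - 1)) (f k)" for k
  define w where "w k \<omega> = inverse (ennreal_sqrt (\<Sum>j=1..k. a j \<omega>))" for k \<omega>
  have sub: "subalgebra M (G k)" if "k \<le> n" for k
    using filt that by (simp add: filtered_prob_space_def)
  have a [measurable]: "a k \<in> borel_measurable M" for k
    unfolding a_def by simp
  \<comment> \<open>Predictability: for \<open>j \<le> k\<close>, \<open>a j\<close> is measurable
    for \<open>G (j - 1)\<close>, which is coarser than \<open>G (k - 1)\<close>.\<close>
  have w_pred: "w k \<in> borel_measurable (G (k - 1))" if "k \<in> {1..n}" for k
  proof -
    have "a j \<in> borel_measurable (G (k - 1))" if "j \<in> {1..k}" for j
    proof (rule measurable_from_subalg)
      show "subalgebra (G (k - 1)) (G (j - 1))"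
        using filt \<open>k \<in> {1..n}\<close> that unfolding filtered_prob_space_def
        by (metis atLeastAtMost_iff diff_le_mono diff_le_self order_trans)
      show "a j \<in> borel_measurable (G (j - 1))"
        unfolding a_def by simp
    qed
    then have [measurable]: "(\<lambda>\<omega>. \<Sum>j=1..k. a j \<omega>) \<in> borel_measurable (G (k - 1))"
      by (intro borel_measurable_sum)
    show ?thesis
      unfolding w_def by measurable
  qed
  have w [measurable]: "w k \<in> borel_measurable M" for k
    unfolding w_def by measurable
  \<comment> \<open>The defining property of conditional expectation, tested against the
    non-negative predictable weight \<open>w k\<close>; infinite values are allowed.\<close>
  have swap: "(\<integral>\<^sup>+ \<omega>. f k \<omega> * w k \<omega> \<partial>M) = (\<integral>\<^sup>+ \<omega>. a k \<omega> * w k \<omega> \<partial>M)" if k: "k \<in> {1..n}" for k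
  proof -
    interpret finite_measure_subalgebra M "G (k - 1)"
      using sub [of "k - 1"] k by unfold_locales auto
    show ?thesis
      using nn_cond_exp_intg [OF w_pred [OF k] f [OF k]] by (simp add: a_def mult.commute)
  qed
  have "2 * (\<integral>\<^sup>+ \<omega>. ennreal_sqrt (\<Sum>k=1..n. f k \<omega>) \<partial>M)
      = (\<integral>\<^sup>+ \<omega>. 2 * ennreal_sqrt (\<Sum>k=1..n. f k \<omega>) \<partial>M)"
    by (rule nn_integral_cmult [symmetric]) measurable
  also have "\<dots> \<le> (\<integral>\<^sup>+ \<omega>. (\<Sum>k=1..n. f k \<omega> * w k \<omega>) + ennreal_sqrt (\<Sum>k=1..n. a k \<omega>) \<partial>M)"
    unfolding w_def by (intro nn_integral_mono sum_ennreal_sqrt_le)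
  also have "\<dots> = (\<Sum>k=1..n. \<integral>\<^sup>+ \<omega>. f k \<omega> * w k \<omega> \<partial>M)
      + (\<integral>\<^sup>+ \<omega>. ennreal_sqrt (\<Sum>k=1..n. a k \<omega>) \<partial>M)"
    by (subst nn_integral_add) (auto intro!: nn_integral_sum)
  also have "(\<Sum>k=1..n. \<integral>\<^sup>+ \<omega>. f k \<omega> * w k \<omega> \<partial>M) = (\<Sum>k=1..n. \<integral>\<^sup>+ \<omega>. a k \<omega> * w k \<omega> \<partial>M)"
    by (rule sum.cong [OF refl swap])
  also have "\<dots> = (\<integral>\<^sup>+ \<omega>. (\<Sum>k=1..n. a k \<omega> * w k \<omega>) \<partial>M)"
    by (rule nn_integral_sum [symmetric]) measurable
  also have "\<dots> \<le> (\<integral>\<^sup>+ \<omega>. 2 * ennreal_sqrt (\<Sum>k=1..n. a k \<omega>) \<partial>M)"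
    unfolding w_def by (intro nn_integral_mono sum_increments_ennreal_sqrt)
  also have "\<dots> = 2 * (\<integral>\<^sup>+ \<omega>. ennreal_sqrt (\<Sum>k=1..n. a k \<omega>) \<partial>M)"
    by (rule nn_integral_cmult) measurable
  \<comment> \<open>The 2 comes from telescoping, the 1 from the square root left over by
    AM-GM.\<close>
  finally have "2 * (\<integral>\<^sup>+ \<omega>. ennreal_sqrt (\<Sum>k=1..n. f k \<omega>) \<partial>M)
      \<le> (2 + 1) * (\<integral>\<^sup>+ \<omega>. ennreal_sqrt (\<Sum>k=1..n. a k \<omega>) \<partial>M)"
    by (simp only: distrib_right mult_1 add_right_mono)
  then show ?thesis
    by (simp add: a_def)
qed

theorem proposition4p3:
  fixes M :: "'a measure" and G :: "nat \<Rightarrow> 'a measure" and n :: nat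
    and F :: "nat \<Rightarrow> 'a \<Rightarrow> complex"
  assumes "filtered_prob_space M G n"
    and "martingale_upto M G n F"
  shows "(\<integral>\<^sup>+ \<omega>. ennreal_sqrt (\<Sum>k=1..n. ennreal ((cmod (mdiff F k \<omega>))\<^sup>2)) \<partial>M)
    \<le> 2 * (\<integral>\<^sup>+ \<omega>. ennreal_sqrt
        (\<Sum>k=1..n. nn_cond_exp M (G (k - 1)) (\<lambda>x. ennreal ((cmod (mdiff F k x))\<^sup>2)) \<omega>) \<partial>M)"
    (is "?L \<le> 2 * ?R")
proof -
  interpret prob_space M
    using assms(1) by (simp add: filtered_prob_space_def)
  have F: "F k \<in> borel_measurable M" if "k \<le> n" for k
    using assms(2) that unfolding martingale_upto_def by (auto intro: borel_measurable_integrable)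
  have "(\<lambda>x. ennreal ((cmod (mdiff F k x))\<^sup>2)) \<in> borel_measurable M" if "k \<in> {1..n}" for k
  proof -
    have [measurable]: "F k \<in> borel_measurable M" "F (k - 1) \<in> borel_measurable M"
      using that by (auto intro: F)
    show ?thesis
      unfolding mdiff_def by measurable
  qed
  with assms(1) have "2 * ?L \<le> 3 * ?R"
    by (rule nn_integral_ennreal_sqrt_sum_le)
  \<comment> \<open>Weakening 3 to 4 leaves a factor 2 on both sides, which cancels because it is
    neither 0 nor infinite.\<close>
  also have "\<dots> \<le> 4 * ?R"
    by (intro mult_right_mono) auto
  also have "\<dots> = 2 * (2 * ?R)"
    by (simp flip: mult.assoc)
  finally show ?thesis
    by (subst (asm) ennreal_mult_le_mult_iff) simp_all
qed

end
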